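(* There are infinitely many (pairwise non-homeomorphic) minimal finite spaces with trivial automorphism group. In fact, the family of finite spaces $(F_k)_{k\in\mathbb{N}}$ defined in the context is a family of asymmetric finite spaces that are pairwise not homotopy equivalent.
   Context: A finite space is a topological space with finitely many points. Finite $T_0$ spaces are identified with finite posets: for a finite $T_0$ space $X$ and $x\in X$, let $U_x$ be the intersection of all open sets containing $x$, and put $x\le y$ iff $U_x\subseteq U_y$. Conversely, a finite poset carries the topology whose open sets are the down-closed subsets. The automorphism group of a finite $T_0$ space is its group of self-homeomorphisms, equivalently the group of order automorphisms of the associated poset, equivalently the group of directed graph automorphisms of its Hasse diagram. A point $x\in X$ is up-beat if there is $y\in X\setminus\{x\}$ with $x<y$ such that $x<z$ implies $y\le z$. It is down-beat if there is $y\in X\setminus\{x\}$ with $y<x$ such that $z<x$ implies $z\le y$. A finite space is minimal if it is $T_0$ and has no up-beat points and no down-beat points. A finite space is asymmetric if its group of homotopy classes of self-homotopy equivalences (homotopy classes of homotopy equivalences $X\to X$ under composition) is trivial. The level of $x$ in a finite poset is the largest $m$ such that there is a chain $x_1<\dots<x_m=x$. For $k\in\mathbb{N}$ (with $0\in\mathbb{N}$), $F_k$ is the finite poset (equivalently finite $T_0$ space) on $2k+8$ points, determined up to isomorphism by the following conditions on its Hasse diagram, where the degree of a vertex is the number of Hasse diagram edges at that vertex, and every edge joins a point of the first (lower) level to a point of the second (upper) level, the lower point being smaller than the upper one: 1. The Hasse diagram has two levels, each with $k+4$ vertices. 2. On each level there are exactly two vertices of degree $2$ and, for each $i\in\{3,\dots,k+4\}$,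 exactly one vertex of degree $i$. 3. On each level, one of the two vertices of degree $2$ is connected to one vertex of degree $2$ on the other level and to the vertex of degree $k+4$ on the other level. 4. On each level, the other vertex of degree $2$ is connected to the vertices of degree $k+3$ and $k+4$ on the other level. *)

theory Defs
  imports "HOL-Analysis.Analysis" "HOL-Algebra.Bij" "HOL-Algebra.Elementary_Groups"
begin

definition min_open :: "'a topology \<Rightarrow> 'a \<Rightarrow> 'a set" where
  "min_open X x = \<Inter>{U. openin X U \<and> x \<in> U}"

definition spec_le :: "'a topology \<Rightarrow> 'a \<Rightarrow> 'a \<Rightarrow> bool" where
  "spec_le X x y \<longleftrightarrow>
     x \<in> topspace X \<and> y \<in> topspace X \<and> min_open X x \<subseteq> min_open X y"

definition spec_less :: "'a topology \<Rightarrow> 'a \<Rightarrow> 'a \<Rightarrow> bool" where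
  "spec_less X x y \<longleftrightarrow> spec_le X x y \<and> x \<noteq> y"

definition up_beat :: "'a topology \<Rightarrow> 'a \<Rightarrow> bool" where
  "up_beat X x \<longleftrightarrow> x \<in> topspace X \<and>
     (\<exists>y \<in> topspace X - {x}. spec_less X x y \<and>
        (\<forall>z \<in> topspace X. spec_less X x z \<longrightarrow> spec_le X y z))"

definition down_beat :: "'a topology \<Rightarrow> 'a \<Rightarrow> bool" where
  "down_beat X x \<longleftrightarrow> x \<in> topspace X \<and>
     (\<exists>y \<in> topspace X - {x}. spec_less X y x \<and>
        (\<forall>z \<in> topspace X. spec_less X z x \<longrightarrow> spec_le X z y))"

definition minimal_finite_space :: "'a topology \<Rightarrow> bool" where
  "minimal_finite_space X \<longleftrightarrow> finite (topspace X) \<and> t0_space X \<and>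
     (\<forall>x \<in> topspace X. \<not> up_beat X x \<and> \<not> down_beat X x)"

text \<open>As in \<open>BijGroup\<close>, the elements are the self-homeomorphisms that are extensional on
  the underlying set, so that each self-homeomorphism is counted once.\<close>

definition homeo_group :: "'a topology \<Rightarrow> ('a \<Rightarrow> 'a) monoid" where
  "homeo_group X =
     (BijGroup (topspace X))
       \<lparr>carrier := {f \<in> extensional (topspace X). homeomorphic_map X X f}\<rparr>"

definition self_homotopy_equivalence :: "'a topology \<Rightarrow> ('a \<Rightarrow> 'a) \<Rightarrow> bool" where
  "self_homotopy_equivalence X f \<longleftrightarrow> continuous_map X X f \<and>
     (\<exists>g. continuous_map X X g \<and>
          homotopic_with (\<lambda>_. True) X X (g \<circ> f) id \<and>
          homotopic_with (\<lambda>_. True) X X (f \<circ> g) id)"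

text \<open>Maps that agree on \<open>topspace X\<close> are homotopic in the sense of
  \<open>homotopic_with (\<lambda>_. True) X X\<close>, so values outside \<open>topspace X\<close> do not split classes.\<close>

definition homotopy_class :: "'a topology \<Rightarrow> ('a \<Rightarrow> 'a) \<Rightarrow> ('a \<Rightarrow> 'a) set" where
  "homotopy_class X f = {g. homotopic_with (\<lambda>_. True) X X f g}"

text \<open>The union in \<open>mult\<close> is the single class of \<open>f \<circ> g\<close>, since homotopy is compatible
  with composition.\<close>

definition homotopy_equivalence_group :: "'a topology \<Rightarrow> ('a \<Rightarrow> 'a) set monoid" where
  "homotopy_equivalence_group X =
     \<lparr>carrier = homotopy_class X ` {f. self_homotopy_equivalence X f},
      mult = \<lambda>A B. \<Union>f \<in> A. \<Union>g \<in> B. homotopy_class X (f \<circ> g),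
      one = homotopy_class X id\<rparr>"

definition asymmetric_space :: "'a topology \<Rightarrow> bool" where
  "asymmetric_space X \<longleftrightarrow>
     finite (topspace X) \<and> trivial_group (homotopy_equivalence_group X)"

text \<open>\<open>hasse X x y\<close>: the Hasse diagram has an edge from \<open>x\<close> up to \<open>y\<close>.\<close>

definition hasse :: "'a topology \<Rightarrow> 'a \<Rightarrow> 'a \<Rightarrow> bool" where
  "hasse X x y \<longleftrightarrow> spec_less X x y \<and> (\<nexists>z. spec_less X x z \<and> spec_less X z y)"

definition connected_to :: "'a topology \<Rightarrow> 'a \<Rightarrow> 'a \<Rightarrow> bool" where
  "connected_to X x y \<longleftrightarrow> hasse X x y \<or> hasse X y x"

definition deg :: "'a topology \<Rightarrow> 'a \<Rightarrow> nat" where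
  "deg X x = card {(u, v). hasse X u v \<and> (u = x \<or> v = x)}"

definition level :: "'a topology \<Rightarrow> 'a \<Rightarrow> nat" where
  "level X x = Max {length xs | xs. xs \<noteq> [] \<and> set xs \<subseteq> topspace X \<and>
                      sorted_wrt (spec_less X) xs \<and> last xs = x}"

definition level_set :: "'a topology \<Rightarrow> nat \<Rightarrow> 'a set" where
  "level_set X m = {x \<in> topspace X. level X x = m}"

text \<open>\<open>is_F k X\<close>: \<open>X\<close> is (a copy of) the finite \<open>T\<^sub>0\<close> space \<open>F\<^sub>k\<close>. The conditions
  determine \<open>X\<close> only up to homeomorphism, hence a predicate. In the last two conditions
  \<open>a\<close> and \<open>b\<close> are the two vertices of degree 2 on level \<open>l\<close>, and \<open>m\<close> is the other
  level.\<close>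

definition is_F :: "nat \<Rightarrow> 'a topology \<Rightarrow> bool" where
  "is_F k X \<longleftrightarrow>
     finite (topspace X) \<and> t0_space X \<and> card (topspace X) = 2 * k + 8 \<and>
     (\<forall>x y. hasse X x y \<longrightarrow> x \<in> level_set X 1 \<and> y \<in> level_set X 2) \<and>
     topspace X = level_set X 1 \<union> level_set X 2 \<and>
     (\<forall>l \<in> {1, 2}. card (level_set X l) = k + 4) \<and>
     (\<forall>l \<in> {1, 2}.
        card {x \<in> level_set X l. deg X x = 2} = 2 \<and>
        (\<forall>i \<in> {3..k + 4}. card {x \<in> level_set X l. deg X x = i} = 1)) \<and>
     (\<forall>(l, m) \<in> {(1, 2), (2, 1)}. \<exists>a b.
        a \<noteq> b \<and> {x \<in> level_set X l. deg X x = 2} = {a, b} \<and>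
        (\<exists>u \<in> level_set X m. deg X u = 2 \<and> connected_to X a u) \<and>
        (\<exists>u \<in> level_set X m. deg X u = k + 4 \<and> connected_to X a u) \<and>
        (\<exists>u \<in> level_set X m. deg X u = k + 3 \<and> connected_to X b u) \<and>
        (\<exists>u \<in> level_set X m. deg X u = k + 4 \<and> connected_to X b u))"

end

theory Submission
  imports Defs
begin

text \<open>Nearby stages of a homotopy between maps of finite spaces are pointwise comparable, and
  on a minimal finite space a continuous map comparable with the identity is the identity.
  Hence homotopy equivalences between minimal finite spaces are homeomorphisms. A
  self-homeomorphism of \<open>F\<^sub>k\<close> preserves levels and degrees, so it fixes every vertex whose degree
  is unique on its level; the neighbours of the remaining two vertices then tell these apart.\<close>

section \<open>The specialization order\<close>

text \<open>Continuity gives only a one-sided comparison: stages near time t lie pointwise below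
  stage t. Points below and points above the identity therefore both have to be handled, one for
  openness of the set of identity times and one for openness of its complement. Minimality of F_k
  comes from counting. The prescribed degrees 2, 2, 3, ..., k+4 already use up all k+4 vertices of a
  level, so no vertex has degree below 2. In a two-level poset a beat point would have exactly one
  neighbour. All this is proved for an arbitrary space satisfying \<open>is_F\<close>, so it covers
  every copy of F_k; the concrete model only shows that copies exist. Since homotopy equivalent
  minimal spaces are homeomorphic, the number of points 2k+8 separates the members of the
  family.\<close>

lemma spec_le_iff:
  "spec_le X x y \<longleftrightarrow> x \<in> topspace X \<and> y \<in> topspace X \<and> (\<forall>U. openin X U \<longrightarrow> y \<in> U \<longrightarrow> x \<in> U)"
  unfolding spec_le_def min_open_def by blast

lemma mem_min_open_iff:
  assumes "y \<in> topspace X"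
  shows "x \<in> min_open X y \<longleftrightarrow> spec_le X x y"
  using assms unfolding spec_le_iff min_open_def by blast

lemma openin_min_open:
  assumes "finite (topspace X)" "x \<in> topspace X"
  shows "openin X (min_open X x)"
proof -
  have "{U. openin X U \<and> x \<in> U} \<subseteq> Pow (topspace X)"
    by (auto dest: openin_subset)
  then have "finite {U. openin X U \<and> x \<in> U}"
    using assms(1) by (meson finite_Pow_iff finite_subset)
  then show ?thesis
    unfolding min_open_def using assms(2) by (intro openin_Inter) auto
qed

lemma spec_le_refl: "x \<in> topspace X \<Longrightarrow> spec_le X x x"
  by (simp add: spec_le_iff)

lemma spec_le_trans: "spec_le X x y \<Longrightarrow> spec_le X y z \<Longrightarrow> spec_le X x z"
  by (auto simp: spec_le_iff)

lemma spec_le_antisym: "t0_space X \<Longrightarrow> spec_le X x y \<Longrightarrow> spec_le X y x \<Longrightarrow> x = y"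
  unfolding spec_le_iff t0_space_def by metis

lemma spec_less_trans:
  "t0_space X \<Longrightarrow> spec_less X x y \<Longrightarrow> spec_less X y z \<Longrightarrow> spec_less X x z"
  unfolding spec_less_def by (metis spec_le_trans spec_le_antisym)

lemma spec_le_continuous_map:
  assumes "continuous_map X Y f" "spec_le X x y"
  shows "spec_le Y (f x) (f y)"
  unfolding spec_le_iff
proof (intro conjI allI impI)
  show "f x \<in> topspace Y" "f y \<in> topspace Y"
    using assms by (auto simp: continuous_map_def spec_le_iff)
  fix U assume U: "openin Y U" "f y \<in> U"
  then have "openin X {z \<in> topspace X. f z \<in> U}"
    using assms(1) by (simp add: continuous_map_def)
  then show "f x \<in> U"
    using assms(2) U by (auto simp: spec_le_iff)
qed

section \<open>Maps homotopic to the identity\<close>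

text \<open>If f moved x, \<open>no_beat\<close> would give a z strictly below x but not below f x.
  By induction on the number of points strictly below, f fixes z, and monotonicity then puts z = f z
  below f x. The relation R is abstract so that the order and its reverse are both
  instances.\<close>

lemma deflation_eq_id:
  assumes "finite A"
    and trans: "\<And>x y z. R x y \<Longrightarrow> R y z \<Longrightarrow> R x z"
    and antisym: "\<And>x y. R x y \<Longrightarrow> R y x \<Longrightarrow> x = y"
    and carrier: "\<And>x y. R x y \<Longrightarrow> x \<in> A \<and> y \<in> A"
    and no_beat: "\<And>x y. x \<in> A \<Longrightarrow> R y x \<Longrightarrow> y \<noteq> x \<Longrightarrow> \<exists>z. R z x \<and> z \<noteq> x \<and> \<not> R z y"
    and mono: "\<And>x y. R x y \<Longrightarrow> R (f x) (f y)"
    and below: "\<And>x. x \<in> A \<Longrightarrow> R (f x) x"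
    and "x \<in> A"
  shows "f x = x"
  using \<open>x \<in> A\<close>
proof (induction "card {z. R z x \<and> z \<noteq> x}" arbitrary: x rule: less_induct)
  case less
  show ?case
  proof (rule ccontr)
    assume "f x \<noteq> x"
    then obtain z where z: "R z x" "z \<noteq> x" "\<not> R z (f x)"
      using no_beat[OF less.prems below[OF less.prems]] by blast
    have "{w. R w z \<and> w \<noteq> z} \<subset> {w. R w x \<and> w \<noteq> x}"
      using z(1,2) trans antisym by blast
    moreover have "finite {w. R w x \<and> w \<noteq> x}"
      using \<open>finite A\<close> carrier by (auto intro: finite_subset[of _ A])
    ultimately have "f z = z"
      using less.hyps z(1) carrier by (meson psubset_card_mono)
    then show False
      using mono[OF z(1)] z(3) by simp
  qed
qed

lemma minimal_below_id:
  assumes X: "minimal_finite_space X" and f: "continuous_map X X f"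
    and below: "\<And>x. x \<in> topspace X \<Longrightarrow> spec_le X (f x) x" and "x \<in> topspace X"
  shows "f x = x"
proof (rule deflation_eq_id[where A = "topspace X" and R = "spec_le X"])
  fix x y assume xy: "x \<in> topspace X" "spec_le X y x" "y \<noteq> x"
  then have "\<not> down_beat X x" "y \<in> topspace X"
    using X by (auto simp: minimal_finite_space_def spec_le_def)
  then show "\<exists>z. spec_le X z x \<and> z \<noteq> x \<and> \<not> spec_le X z y"
    using xy unfolding down_beat_def spec_less_def by blast
next
  show "\<And>x y. spec_le X x y \<Longrightarrow> x \<in> topspace X \<and> y \<in> topspace X"
    by (simp add: spec_le_def)
  show "finite (topspace X)" and "\<And>x y. spec_le X x y \<Longrightarrow> spec_le X y x \<Longrightarrow> x = y"
    using X spec_le_antisym[of X] by (auto simp: minimal_finite_space_def)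
  show "\<And>x y z. spec_le X x y \<Longrightarrow> spec_le X y z \<Longrightarrow> spec_le X x z"
    by (rule spec_le_trans)
  show "\<And>x y. spec_le X x y \<Longrightarrow> spec_le X (f x) (f y)"
    by (rule spec_le_continuous_map[OF f])
qed (use assms in auto)

lemma minimal_above_id:
  assumes X: "minimal_finite_space X" and f: "continuous_map X X f"
    and above: "\<And>x. x \<in> topspace X \<Longrightarrow> spec_le X x (f x)" and "x \<in> topspace X"
  shows "f x = x"
proof (rule deflation_eq_id[where A = "topspace X" and R = "\<lambda>x y. spec_le X y x"])
  fix x y assume xy: "x \<in> topspace X" "spec_le X x y" "y \<noteq> x"
  then have "\<not> up_beat X x" "y \<in> topspace X"
    using X by (auto simp: minimal_finite_space_def spec_le_def)
  then show "\<exists>z. spec_le X x z \<and> z \<noteq> x \<and> \<not> spec_le X y z"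
    using xy unfolding up_beat_def spec_less_def by blast
next
  show "\<And>x y. spec_le X y x \<Longrightarrow> x \<in> topspace X \<and> y \<in> topspace X"
    by (simp add: spec_le_def)
  show "finite (topspace X)" and "\<And>x y. spec_le X y x \<Longrightarrow> spec_le X x y \<Longrightarrow> x = y"
    using X spec_le_antisym[of X] by (auto simp: minimal_finite_space_def)
  show "\<And>x y z. spec_le X y x \<Longrightarrow> spec_le X z y \<Longrightarrow> spec_le X z x"
    by (blast intro: spec_le_trans)
  show "\<And>x y. spec_le X y x \<Longrightarrow> spec_le X (f y) (f x)"
    by (rule spec_le_continuous_map[OF f])
qed (use assms in auto)

text \<open>Lying in the minimal open set of h (t, x) means lying below h (t, x), so the preimage of
  that open set gives a neighbourhood of t for each x. Finiteness of X allows these neighbourhoods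
  to be intersected.\<close>

lemma homotopy_locally_below:
  assumes fin: "finite (topspace X)" "finite (topspace Y)"
    and h: "continuous_map (prod_topology T X) Y h" and t: "t \<in> topspace T"
  shows "\<exists>V. openin T V \<and> t \<in> V \<and> (\<forall>s \<in> V. \<forall>x \<in> topspace X. spec_le Y (h (s, x)) (h (t, x)))"
proof -
  have "\<exists>V. openin T V \<and> t \<in> V \<and> (\<forall>s \<in> V. spec_le Y (h (s, x)) (h (t, x)))"
    if x: "x \<in> topspace X" for x
  proof -
    let ?W = "{p \<in> topspace (prod_topology T X). h p \<in> min_open Y (h (t, x))}"
    have hx: "h (t, x) \<in> topspace Y"
      using h t x by (auto simp: continuous_map_def)
    have "openin (prod_topology T X) ?W"
      using h openin_min_open[OF fin(2) hx] by (simp add: continuous_map_def)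
    moreover have "(t, x) \<in> ?W"
      using t x hx by (simp add: mem_min_open_iff spec_le_refl)
    ultimately obtain V U where "openin T V" "t \<in> V" "x \<in> U" "V \<times> U \<subseteq> ?W"
      unfolding openin_prod_topology_alt by blast
    then show ?thesis
      using mem_min_open_iff[OF hx] by blast
  qed
  then obtain V where V: "\<And>x. x \<in> topspace X \<Longrightarrow> openin T (V x) \<and> t \<in> V x \<and>
      (\<forall>s \<in> V x. spec_le Y (h (s, x)) (h (t, x)))"
    by metis
  show ?thesis
  \<comment> \<open>An empty intersection would be the universal set, which need not be open in
    T.\<close>
  proof (cases "topspace X = {}")
    case True
    then show ?thesis using t by auto
  next
    case False
    then have "openin T (\<Inter>x \<in> topspace X. V x)"
      using V fin(1) by (intro openin_INT2) auto
    then show ?thesis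
      using V by (intro exI[of _ "\<Inter>x \<in> topspace X. V x"]) auto
  qed
qed

text \<open>The set of times at which the homotopy is the identity is clopen in the unit interval.\<close>

lemma homotopic_id_eq_id:
  assumes X: "minimal_finite_space X" and hom: "homotopic_with (\<lambda>_. True) X X f id"
    and x: "x \<in> topspace X"
  shows "f x = x"
proof -
  let ?I = "top_of_set {0..1::real}"
  obtain h where h: "continuous_map (prod_topology ?I X) X h"
    and h0: "\<And>x. h (0, x) = f x" and h1: "\<And>x. h (1, x) = x"
    using hom unfolding homotopic_with_def by auto
  have fin: "finite (topspace X)"
    using X by (simp add: minimal_finite_space_def)
  have stage: "continuous_map X X (\<lambda>x. h (t, x))" if "t \<in> {0..1}" for t
    using continuous_map_compose[OF _ h, of X "\<lambda>x. (t, x)"] that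
    by (simp add: o_def continuous_map_pairwise)
  define A where "A = {t \<in> {0..1}. \<forall>x \<in> topspace X. h (t, x) = x}"
  note near = homotopy_locally_below[OF fin fin h]
  \<comment> \<open>Near an identity time all stages lie below the identity, hence equal it.\<close>
  have "\<exists>V. openin ?I V \<and> t \<in> V \<and> V \<subseteq> A" if t: "t \<in> A" for t
  proof -
    obtain V where V: "openin ?I V" "t \<in> V"
      "\<forall>s \<in> V. \<forall>x \<in> topspace X. spec_le X (h (s, x)) (h (t, x))"
      using near[of t] t by (auto simp: A_def)
    have sub: "V \<subseteq> {0..1}"
      using openin_subset[OF V(1)] by simp
    have "h (s, x) = x" if "s \<in> V" "x \<in> topspace X" for s x
    proof (rule minimal_below_id[OF X stage])
      show "s \<in> {0..1}" using sub that by blast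
    qed (use V(3) t that in \<open>auto simp: A_def\<close>)
    then show ?thesis
      using V(1,2) sub unfolding A_def by blast
  qed
  then have opn: "openin ?I A"
    by (subst openin_subopen) blast
  \<comment> \<open>The same comparison read from the other side: an identity time s near t would
    place stage t above the identity and so make t an identity time too.\<close>
  have "\<exists>V. openin ?I V \<and> t \<in> V \<and> V \<subseteq> {0..1} - A" if t: "t \<in> {0..1} - A" for t
  proof -
    obtain V where V: "openin ?I V" "t \<in> V"
      "\<forall>s \<in> V. \<forall>x \<in> topspace X. spec_le X (h (s, x)) (h (t, x))"
      using near[of t] t by auto
    have sub: "V \<subseteq> {0..1}"
      using openin_subset[OF V(1)] by simp
    have "s \<notin> A" if "s \<in> V" for s
    proof
      assume "s \<in> A"
      then have "h (t, x) = x" if "x \<in> topspace X" for x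
        using V(3) \<open>s \<in> V\<close> t that
        by (intro minimal_above_id[OF X stage]) (auto simp: A_def)
      then show False
        using t by (auto simp: A_def)
    qed
    then show ?thesis
      using V(1,2) sub by blast
  qed
  then have "openin ?I ({0..1} - A)"
    by (subst openin_subopen) blast
  then have "closedin ?I A"
    by (auto simp: closedin_def A_def)
  moreover have "connected {0..1::real}" by simp
  ultimately have "A = {} \<or> A = {0..1}"
    using opn by (simp add: connected_clopen)
  moreover have "1 \<in> A"
    by (simp add: A_def h1)
  ultimately have "0 \<in> A"
    by auto
  then show ?thesis
    using x h0 by (simp add: A_def)
qed

section \<open>Homotopy equivalences of minimal spaces and the groups they form\<close>

lemma minimal_homotopy_inverse:
  assumes "minimal_finite_space X" "minimal_finite_space Y"
    and "continuous_map X Y f" "continuous_map Y X g"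
    and "homotopic_with (\<lambda>_. True) X X (g \<circ> f) id"
    and "homotopic_with (\<lambda>_. True) Y Y (f \<circ> g) id"
  shows "homeomorphic_maps X Y f g"
  unfolding homeomorphic_maps_def
  using assms(3,4) homotopic_id_eq_id[OF assms(1,5)] homotopic_id_eq_id[OF assms(2,6)] by simp

lemma homotopy_equivalent_minimal_imp_homeomorphic:
  assumes "minimal_finite_space X" "minimal_finite_space Y" "X homotopy_equivalent_space Y"
  shows "X homeomorphic_space Y"
  using assms minimal_homotopy_inverse
  unfolding homotopy_equivalent_space_def homeomorphic_space_def by blast

lemma homeomorphic_space_card_eq:
  assumes "X homeomorphic_space Y"
  shows "card (topspace X) = card (topspace Y)"
proof -
  obtain f where "homeomorphic_map X Y f"
    using assms by (auto simp: homeomorphic_space)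
  then have "bij_betw f (topspace X) (topspace Y)"
    by (simp add: bij_betw_def homeomorphic_imp_injective_map homeomorphic_imp_surjective_map)
  then show ?thesis
    by (rule bij_betw_same_card)
qed

lemma trivial_groupI:
  assumes "carrier G = {\<one>\<^bsub>G\<^esub>}" "\<one>\<^bsub>G\<^esub> \<otimes>\<^bsub>G\<^esub> \<one>\<^bsub>G\<^esub> = \<one>\<^bsub>G\<^esub>"
  shows "trivial_group G"
  unfolding trivial_group_def
proof
  show "group G"
    by (rule groupI) (simp_all add: assms)
qed (rule assms(1))

lemma trivial_homeo_group:
  assumes "\<And>f g x. homeomorphic_maps X X f g \<Longrightarrow> x \<in> topspace X \<Longrightarrow> f x = x"
  shows "trivial_group (homeo_group X)"
proof (rule trivial_groupI)
  \<comment> \<open>The unit of \<open>BijGroup\<close> is the restricted identity; extensionality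
    fixes the values outside the space.\<close>
  have "f = (\<lambda>x \<in> topspace X. x)" if "f \<in> extensional (topspace X)" "homeomorphic_map X X f" for f
    using that assms unfolding homeomorphic_map_maps by (auto simp: fun_eq_iff extensional_def)
  moreover have "homeomorphic_map X X (\<lambda>x \<in> topspace X. x)"
    by (rule homeomorphic_map_eq[of X X id]) simp_all
  ultimately show "carrier (homeo_group X) = {\<one>\<^bsub>homeo_group X\<^esub>}"
    by (auto simp: homeo_group_def BijGroup_def)
  show "\<one>\<^bsub>homeo_group X\<^esub> \<otimes>\<^bsub>homeo_group X\<^esub> \<one>\<^bsub>homeo_group X\<^esub> = \<one>\<^bsub>homeo_group X\<^esub>"
    by (auto simp: homeo_group_def BijGroup_def id_Bij compose_def fun_eq_iff)
qed

lemma homotopy_class_eq_id: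
  assumes "\<And>x. x \<in> topspace X \<Longrightarrow> f x = x"
  shows "homotopy_class X f = homotopy_class X id"
proof -
  have "homotopic_with (\<lambda>_. True) X X f id"
    using assms by (intro homotopic_with_equal) (auto intro: continuous_map_eq[OF continuous_map_id])
  then show ?thesis
    unfolding homotopy_class_def using homotopic_with_trans homotopic_with_symD by blast
qed

lemma minimal_asymmetric_space:
  assumes X: "minimal_finite_space X"
    and rigid: "\<And>f g x. homeomorphic_maps X X f g \<Longrightarrow> x \<in> topspace X \<Longrightarrow> f x = x"
  shows "asymmetric_space X"
  unfolding asymmetric_space_def
proof
  let ?G = "homotopy_equivalence_group X"
  let ?e = "homotopy_class X id"
  show "finite (topspace X)"
    using X by (simp add: minimal_finite_space_def)
  have id_eq: "f x = x" if "f \<in> ?e" "x \<in> topspace X" for f x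
    using that homotopic_id_eq_id[OF X] by (simp add: homotopy_class_def homotopic_with_symD)
  have mem: "id \<in> ?e"
    by (simp add: homotopy_class_def)
  show "trivial_group ?G"
  proof (rule trivial_groupI)
    have "homotopy_class X f = ?e" if f: "self_homotopy_equivalence X f" for f
    proof -
      obtain g where "homeomorphic_maps X X f g"
        using f minimal_homotopy_inverse[OF X X] unfolding self_homotopy_equivalence_def by auto
      then show ?thesis
        using rigid homotopy_class_eq_id by metis
    qed
    moreover have "self_homotopy_equivalence X id"
      unfolding self_homotopy_equivalence_def by (auto intro!: exI[of _ id])
    ultimately have "homotopy_class X ` {f. self_homotopy_equivalence X f} = {?e}"
      by blast
    then show "carrier ?G = {\<one>\<^bsub>?G\<^esub>}"
      by (simp add: homotopy_equivalence_group_def)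
    \<comment> \<open>The product is a union over all representatives, so every pair must give the
      class \<open>?e\<close>; \<open>mem\<close> ensures that the union is not empty.\<close>
    have "homotopy_class X (f \<circ> g) = ?e" if "f \<in> ?e" "g \<in> ?e" for f g
      using id_eq[OF that(1)] id_eq[OF that(2)] by (intro homotopy_class_eq_id) simp
    then have "(\<Union>f \<in> ?e. \<Union>g \<in> ?e. homotopy_class X (f \<circ> g)) = ?e"
      using mem by blast
    then show "\<one>\<^bsub>?G\<^esub> \<otimes>\<^bsub>?G\<^esub> \<one>\<^bsub>?G\<^esub> = \<one>\<^bsub>?G\<^esub>"
      by (simp add: homotopy_equivalence_group_def)
  qed
qed

section \<open>The spaces F\<close>

text \<open>An edge at x is determined by its other end. Antisymmetry leaves only one orientation
  for each neighbour, so \<open>?edge\<close> hits every edge.\<close>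

lemma deg_eq_card_connected:
  assumes "t0_space X"
  shows "deg X x = card {v. connected_to X x v}"
proof -
  let ?edge = "\<lambda>v. if hasse X x v then (x, v) else (v, x)"
  have asym: "\<not> hasse X v x" if "hasse X x v" for v
    using that assms unfolding hasse_def spec_less_def by (metis spec_le_antisym)
  have "{(u, v). hasse X u v \<and> (u = x \<or> v = x)} = ?edge ` {v. connected_to X x v}"
    using asym by (auto simp: connected_to_def image_iff split: if_splits)
  moreover have "inj_on ?edge {v. connected_to X x v}"
    by (auto simp: inj_on_def split: if_splits)
  ultimately show ?thesis
    unfolding deg_def by (simp only: card_image)
qed

lemma spec_less_homeomorphic_maps:
  assumes "homeomorphic_maps X X f g" "x \<in> topspace X" "y \<in> topspace X"
  shows "spec_less X (f x) (f y) \<longleftrightarrow> spec_less X x y"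
  using assms spec_le_continuous_map[of X X f x y] spec_le_continuous_map[of X X g "f x" "f y"]
  unfolding homeomorphic_maps_def spec_less_def by metis

text \<open>Takes \<open>is_F\<close> apart once. The last fact forgets on which level the
  neighbours lie, because their degrees alone will distinguish the two vertices of degree 2.\<close>

lemma is_FD:
  assumes "is_F k X"
  shows "finite (topspace X)" "t0_space X" "card (topspace X) = 2 * k + 8"
    and "\<And>x y. hasse X x y \<Longrightarrow> x \<in> level_set X 1 \<and> y \<in> level_set X 2"
    and "\<And>x. x \<in> topspace X \<Longrightarrow> x \<in> level_set X 1 \<or> x \<in> level_set X 2"
    and "\<And>l. l \<in> {1, 2} \<Longrightarrow> card (level_set X l) = k + 4"
    and "\<And>l. l \<in> {1, 2} \<Longrightarrow> card {x \<in> level_set X l. deg X x = 2} = 2"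
    and "\<And>l i. l \<in> {1, 2} \<Longrightarrow> i \<in> {3..k + 4} \<Longrightarrow> card {x \<in> level_set X l. deg X x = i} = 1"
    and "\<And>l. l \<in> {1, 2} \<Longrightarrow> \<exists>a b. a \<noteq> b \<and> {x \<in> level_set X l. deg X x = 2} = {a, b} \<and>
        (\<exists>u. deg X u = 2 \<and> connected_to X a u) \<and>
        (\<exists>u. deg X u = k + 4 \<and> connected_to X a u) \<and>
        (\<exists>u. deg X u = k + 3 \<and> connected_to X b u)"
proof -
  note F = assms[unfolded is_F_def]
  have levels: "\<forall>x y. hasse X x y \<longrightarrow> x \<in> level_set X 1 \<and> y \<in> level_set X 2"
    "topspace X = level_set X 1 \<union> level_set X 2"
    and cards: "\<forall>l \<in> {1, 2}. card (level_set X l) = k + 4"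
      "\<forall>l \<in> {1, 2}. card {x \<in> level_set X l. deg X x = 2} = 2 \<and>
        (\<forall>i \<in> {3..k + 4}. card {x \<in> level_set X l. deg X x = i} = 1)"
    and nbrs: "\<forall>(l, m) \<in> {(1, 2), (2, 1)}. \<exists>a b.
        a \<noteq> b \<and> {x \<in> level_set X l. deg X x = 2} = {a, b} \<and>
        (\<exists>u \<in> level_set X m. deg X u = 2 \<and> connected_to X a u) \<and>
        (\<exists>u \<in> level_set X m. deg X u = k + 4 \<and> connected_to X a u) \<and>
        (\<exists>u \<in> level_set X m. deg X u = k + 3 \<and> connected_to X b u) \<and>
        (\<exists>u \<in> level_set X m. deg X u = k + 4 \<and> connected_to X b u)"
    using F by - ((elim conjE, assumption)+)
  show "finite (topspace X)" "t0_space X" "card (topspace X) = 2 * k + 8"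
    using F by - ((elim conjE, assumption)+)
  show "\<And>x y. hasse X x y \<Longrightarrow> x \<in> level_set X 1 \<and> y \<in> level_set X 2"
    "\<And>x. x \<in> topspace X \<Longrightarrow> x \<in> level_set X 1 \<or> x \<in> level_set X 2"
    using levels by blast+
  show "\<And>l. l \<in> {1, 2} \<Longrightarrow> card (level_set X l) = k + 4"
    "\<And>l. l \<in> {1, 2} \<Longrightarrow> card {x \<in> level_set X l. deg X x = 2} = 2"
    "\<And>l i. l \<in> {1, 2} \<Longrightarrow> i \<in> {3..k + 4} \<Longrightarrow> card {x \<in> level_set X l. deg X x = i} = 1"
    using cards by blast+
  fix l :: nat assume "l \<in> {1, 2}"
  then obtain m where "(l, m) \<in> {(1::nat, 2::nat), (2, 1)}" by auto
  from bspec[OF nbrs this]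
  show "\<exists>a b. a \<noteq> b \<and> {x \<in> level_set X l. deg X x = 2} = {a, b} \<and>
        (\<exists>u. deg X u = 2 \<and> connected_to X a u) \<and>
        (\<exists>u. deg X u = k + 4 \<and> connected_to X a u) \<and>
        (\<exists>u. deg X u = k + 3 \<and> connected_to X b u)"
    unfolding prod.case by blast
qed

lemma level_set_disjoint: "x \<in> level_set X 1 \<Longrightarrow> x \<notin> level_set X 2"
  by (simp add: level_set_def)

text \<open>The levels in \<open>is_F\<close> constrain Hasse edges only. If z lay strictly between
  x and y, induction on the number of intermediate points would make both halves Hasse edges,
  putting z on level 2 as an upper end and on level 1 as a lower end.\<close>

lemma is_F_spec_less_imp_hasse:
  assumes F: "is_F k X" and "spec_less X x y"
  shows "hasse X x y"
  using \<open>spec_less X x y\<close>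
proof (induction "card {w. spec_less X x w \<and> spec_less X w y}" arbitrary: x y rule: less_induct)
  case less
  note trans = spec_less_trans[OF is_FD(2)[OF F]]
  show ?case
  proof (rule ccontr)
    assume "\<not> hasse X x y"
    then obtain z where z: "spec_less X x z" "spec_less X z y"
      using less.prems by (auto simp: hasse_def)
    have irrefl: "\<not> spec_less X z z"
      by (simp add: spec_less_def)
    have fin: "finite {w. spec_less X x w \<and> spec_less X w y}"
      by (rule finite_subset[OF _ is_FD(1)[OF F]]) (auto simp: spec_less_def spec_le_def)
    have "{w. spec_less X x w \<and> spec_less X w z} \<subset> {w. spec_less X x w \<and> spec_less X w y}"
      "{w. spec_less X z w \<and> spec_less X w y} \<subset> {w. spec_less X x w \<and> spec_less X w y}"
      using z irrefl trans by blast+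
    then have "hasse X x z" "hasse X z y"
      using less.hyps z psubset_card_mono[OF fin] by blast+
    then show False
      using is_FD(4)[OF F] level_set_disjoint by metis
  qed
qed

lemma is_F_connected_iff:
  assumes "is_F k X"
  shows "connected_to X x y \<longleftrightarrow> spec_less X x y \<or> spec_less X y x"
  using is_F_spec_less_imp_hasse[OF assms] by (auto simp: connected_to_def hasse_def)

lemma is_F_spec_less_levels:
  assumes "is_F k X" "spec_less X x y"
  shows "x \<in> level_set X 1" "y \<in> level_set X 2"
  using is_F_spec_less_imp_hasse[OF assms] is_FD(4)[OF assms(1)] by blast+

text \<open>The disjoint degree classes for 2, ..., k+4 contain 2 + (k+2) = k+4 vertices, which is
  the whole level.\<close>

lemma is_F_deg_bounds:
  assumes F: "is_F k X" and x: "x \<in> topspace X"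
  shows "deg X x \<in> {2..k + 4}"
proof -
  obtain l where l: "l \<in> {1, 2}" "x \<in> level_set X l"
    using is_FD(5)[OF F x] by blast
  have fin: "finite (level_set X l)"
    by (rule finite_subset[OF _ is_FD(1)[OF F]]) (auto simp: level_set_def)
  let ?D = "\<lambda>i. {x \<in> level_set X l. deg X x = i}"
  have "card (\<Union>i \<in> {2..k + 4}. ?D i) = (\<Sum>i \<in> {2..k + 4}. card (?D i))"
    using fin by (intro card_UN_disjoint) auto
  also have "\<dots> = card (?D 2) + (\<Sum>i \<in> {3..k + 4}. card (?D i))"
    by (subst sum.atLeast_Suc_atMost) (auto simp: numeral_3_eq_3 numeral_2_eq_2)
  also have "\<dots> = k + 4"
    using is_FD(7,8)[OF F l(1)] by simp
  finally have "card (\<Union>i \<in> {2..k + 4}. ?D i) = card (level_set X l)"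
    using is_FD(6)[OF F l(1)] by simp
  then have "(\<Union>i \<in> {2..k + 4}. ?D i) = level_set X l"
    using fin by (intro card_subset_eq) auto
  then show ?thesis
    using l(2) by blast
qed

text \<open>Stated with an arbitrary y to avoid: below, y is the point that would witness a beat
  point.\<close>

lemma is_F_two_neighbours:
  assumes F: "is_F k X" and x: "x \<in> topspace X"
  shows "\<exists>z. z \<noteq> y \<and> connected_to X x z"
proof (rule ccontr)
  assume "\<not> ?thesis"
  then have "{v. connected_to X x v} \<subseteq> {y}" by blast
  then have "card {v. connected_to X x v} \<le> 1"
    using card_mono[of "{y}"] by simp
  then show False
    using is_F_deg_bounds[OF F x] deg_eq_card_connected[OF is_FD(2)[OF F]] by simp
qed

text \<open>A neighbour of x other than the beat witness y lies on the same side of x as y. The beat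
  condition makes it comparable with y, although both are on one level.\<close>

lemma is_F_minimal:
  assumes F: "is_F k X"
  shows "minimal_finite_space X"
  unfolding minimal_finite_space_def
proof (intro conjI ballI)
  show "finite (topspace X)" "t0_space X"
    by (fact is_FD(1,2)[OF F])+
next
  fix x assume x: "x \<in> topspace X"
  note lev = is_F_spec_less_levels[OF F] level_set_disjoint
  show "\<not> up_beat X x"
  proof
    assume "up_beat X x"
    then obtain y where y: "spec_less X x y"
      "\<And>z. z \<in> topspace X \<Longrightarrow> spec_less X x z \<Longrightarrow> spec_le X y z"
      unfolding up_beat_def by blast
    obtain z where z: "z \<noteq> y" "connected_to X x z"
      using is_F_two_neighbours[OF F x] by blast
    then have "spec_less X x z"
      using lev y(1) is_F_connected_iff[OF F] by metis
    then have "spec_less X y z"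
      using y(2)[of z] z(1) by (auto simp: spec_less_def spec_le_def)
    then show False
      using lev y(1) by metis
  qed
  show "\<not> down_beat X x"
  proof
    assume "down_beat X x"
    then obtain y where y: "spec_less X y x"
      "\<And>z. z \<in> topspace X \<Longrightarrow> spec_less X z x \<Longrightarrow> spec_le X z y"
      unfolding down_beat_def by blast
    obtain z where z: "z \<noteq> y" "connected_to X x z"
      using is_F_two_neighbours[OF F x] by blast
    then have "spec_less X z x"
      using lev y(1) is_F_connected_iff[OF F] by metis
    then have "spec_less X z y"
      using y(2)[of z] z(1) by (auto simp: spec_less_def spec_le_def)
    then show False
      using lev y(1) by metis
  qed
qed

section \<open>Rigidity of F_k under self-homeomorphisms\<close>

lemma is_F_homeo_connected:
  assumes F: "is_F k X" and fg: "homeomorphic_maps X X f g"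
    and "x \<in> topspace X" "y \<in> topspace X"
  shows "connected_to X (f x) (f y) \<longleftrightarrow> connected_to X x y"
  using assms(3,4) is_F_connected_iff[OF F] spec_less_homeomorphic_maps[OF fg] by simp

lemma connected_to_topspace:
  "connected_to X x y \<Longrightarrow> x \<in> topspace X \<and> y \<in> topspace X"
  by (auto simp: connected_to_def hasse_def spec_less_def spec_le_def)

lemma is_F_homeo_deg:
  assumes F: "is_F k X" and fg: "homeomorphic_maps X X f g" and x: "x \<in> topspace X"
  shows "deg X (f x) = deg X x"
proof -
  have f: "f y \<in> topspace X" "g y \<in> topspace X" "g (f y) = y" "f (g y) = y"
    if "y \<in> topspace X" for y
    using fg that by (auto simp: homeomorphic_maps_def continuous_map_def)
  have "{v. connected_to X (f x) v} = f ` {v. connected_to X x v}" 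
  proof (intro Set.set_eqI iffI)
    fix v assume "v \<in> {v. connected_to X (f x) v}"
    then have v: "connected_to X (f x) v" "v \<in> topspace X"
      by (auto dest: connected_to_topspace)
    then have "connected_to X x (g v)"
      using is_F_homeo_connected[OF F fg x, of "g v"] f by simp
    then show "v \<in> f ` {v. connected_to X x v}"
      using f(4)[OF v(2)] by (metis imageI mem_Collect_eq)
  next
    fix v assume "v \<in> f ` {v. connected_to X x v}"
    then show "v \<in> {v. connected_to X (f x) v}"
      using is_F_homeo_connected[OF F fg x] connected_to_topspace by fastforce
  qed
  moreover have "inj_on f {v. connected_to X x v}"
    using f(3) connected_to_topspace by (metis (mono_tags, lifting) inj_onI mem_Collect_eq)
  ultimately show ?thesis
    by (simp add: deg_eq_card_connected[OF is_FD(2)[OF F]] card_image)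
qed

text \<open>Chains need not be transported: every vertex has a neighbour, its level is decided by
  whether it lies below or above that neighbour, and f preserves this.\<close>

lemma is_F_homeo_level:
  assumes F: "is_F k X" and fg: "homeomorphic_maps X X f g" and x: "x \<in> level_set X l"
  shows "f x \<in> level_set X l"
proof -
  have xX: "x \<in> topspace X"
    using x by (simp add: level_set_def)
  obtain z where z: "connected_to X x z"
    using is_F_two_neighbours[OF F xX] by blast
  then have zX: "z \<in> topspace X"
    by (simp add: connected_to_topspace)
  note lev = is_F_spec_less_levels[OF F]
  have "level X (f x) = level X x \<and> f x \<in> topspace X"
  proof (cases "spec_less X x z")
    case True
    then have "spec_less X (f x) (f z)"
      using spec_less_homeomorphic_maps[OF fg xX zX] by simp
    then show ?thesis
      using lev(1)[OF True] lev(1)[of "f x"] by (simp add: level_set_def)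
  next
    case False
    then have *: "spec_less X z x"
      using z is_F_connected_iff[OF F] by simp
    then have "spec_less X (f z) (f x)"
      using spec_less_homeomorphic_maps[OF fg zX xX] by simp
    then show ?thesis
      using lev(2)[OF *] lev(2)[of _ "f x"] by (simp add: level_set_def)
  qed
  then show ?thesis
    using x by (simp add: level_set_def)
qed

text \<open>The two vertices of degree 2 on a level are told apart by the degrees of their
  neighbours: only the second one has a neighbour of degree \<open>k + 3\<close>.\<close>

lemma is_F_rigid:
  assumes F: "is_F k X" and fg: "homeomorphic_maps X X f g" and x: "x \<in> topspace X"
  shows "f x = x"
proof -
  obtain l where l: "l \<in> {1, 2}" "x \<in> level_set X l"
    using is_FD(5)[OF F x] by blast
  have fin: "finite (topspace X)"
    by (fact is_FD(1)[OF F])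
  have f: "f y \<in> level_set X l \<and> deg X (f y) = deg X y" if "y \<in> level_set X l" for y
    using is_F_homeo_level[OF F fg that] is_F_homeo_deg[OF F fg] that by (simp add: level_set_def)
  show ?thesis
  proof (cases "deg X x = 2")
    case False
    then have "deg X x \<in> {3..k + 4}"
      using is_F_deg_bounds[OF F x] by auto
    then have "card {y \<in> level_set X l. deg X y = deg X x} = 1"
      by (rule is_FD(8)[OF F l(1)])
    then obtain c where "{y \<in> level_set X l. deg X y = deg X x} = {c}"
      by (rule card_1_singletonE)
    then have "x \<in> {c}" "f x \<in> {c}"
      using f[OF l(2)] l(2) by blast+
    then show ?thesis
      by simp
  next
    case True
    obtain a b u v w where ab: "a \<noteq> b" "{x \<in> level_set X l. deg X x = 2} = {a, b}"
      and u: "deg X u = 2" "connected_to X a u"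
      and v: "deg X v = k + 4" "connected_to X a v"
      and w: "deg X w = k + 3" "connected_to X b w"
      using is_FD(9)[OF F l(1)] by blast
    have a: "a \<in> level_set X l" "deg X a = 2" and b: "b \<in> level_set X l" "deg X b = 2"
      using ab(2) by blast+
    have nb: "finite {z. connected_to X a z}"
      by (rule finite_subset[OF _ fin]) (auto dest: connected_to_topspace)
    \<comment> \<open>u and v are distinct since 2 and k+4 differ, so they exhaust the neighbours of
      a, which has degree 2.\<close>
    have "{u, v} \<subseteq> {z. connected_to X a z}" "card {u, v} = card {z. connected_to X a z}"
      using u v a(2) deg_eq_card_connected[OF is_FD(2)[OF F], of a]
      by (auto simp: card_insert_if)
    then have nb_a: "{z. connected_to X a z} = {u, v}"
      by (metis card_subset_eq nb)
    have "connected_to X (f b) (f w)" "deg X (f w) = k + 3"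
      using w is_F_homeo_connected[OF F fg] is_F_homeo_deg[OF F fg] connected_to_topspace
      by metis+
    \<comment> \<open>f w is a neighbour of f b of degree k+3, and k+3 is neither 2 nor k+4.\<close>
    then have "f b \<noteq> a"
      using nb_a u(1) v(1) by (auto dest: arg_cong[where f = "(\<in>) (f w)"])
    moreover have two: "y = a \<or> y = b" if "y \<in> level_set X l" "deg X y = 2" for y
      using that ab(2) by blast
    ultimately have fb: "f b = b"
      using f[OF b(1)] b(2) by auto
    have "g (f a) = a" "g (f b) = b"
      using fg a(1) b(1) by (auto simp: homeomorphic_maps_def level_set_def)
    then have "f a \<noteq> f b"
      using ab(1) by auto
    then have "f a = a"
      using two[of "f a"] f[OF a(1)] a(2) fb by auto
    then show ?thesis
      using fb two[OF l(2) True] by auto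
  qed
qed

section \<open>A model of F\<close>

text \<open>Since the sides are disjoint, edges never compose. Hence E is already a strict order and
  its own Hasse relation, and the down-closed sets form a T0 topology inducing it.\<close>

locale bipartite_poset =
  fixes L M :: "'a set" and E :: "'a \<Rightarrow> 'a \<Rightarrow> bool"
  assumes disjoint: "L \<inter> M = {}"
    and edge: "\<And>x y. E x y \<Longrightarrow> x \<in> L \<and> y \<in> M"
begin

definition space :: "'a topology" where
  "space = topology (\<lambda>U. U \<subseteq> L \<union> M \<and> (\<forall>x y. E x y \<longrightarrow> y \<in> U \<longrightarrow> x \<in> U))"

lemma openin_space:
  "openin space U \<longleftrightarrow> U \<subseteq> L \<union> M \<and> (\<forall>x y. E x y \<longrightarrow> y \<in> U \<longrightarrow> x \<in> U)"
proof -
  have "istopology (\<lambda>U. U \<subseteq> L \<union> M \<and> (\<forall>x y. E x y \<longrightarrow> y \<in> U \<longrightarrow> x \<in> U))"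
    unfolding istopology_def by blast
  then show ?thesis
    by (simp add: space_def topology_inverse')
qed

lemma topspace_space: "topspace space = L \<union> M"
proof
  have "openin space (L \<union> M)"
    using edge by (auto simp: openin_space)
  then show "L \<union> M \<subseteq> topspace space"
    by (rule openin_subset)
  show "topspace space \<subseteq> L \<union> M"
    using openin_space openin_topspace by blast
qed

lemma no_path: "E x y \<Longrightarrow> \<not> E y z"
  using edge[of x y] edge[of y z] disjoint by blast

lemma spec_le_space: "spec_le space x y \<longleftrightarrow> x \<in> L \<union> M \<and> (x = y \<or> E x y)"
proof
  assume le: "spec_le space x y"
  then have xy: "x \<in> L \<union> M" "y \<in> L \<union> M"
    by (simp_all add: spec_le_def topspace_space)
  \<comment> \<open>This is the minimal open set of y: nothing lies below a lower neighbour of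
    y.\<close>
  then have "openin space (insert y {z. E z y})"
    using edge no_path by (auto simp: openin_space)
  then show "x \<in> L \<union> M \<and> (x = y \<or> E x y)"
    using le xy by (auto simp: spec_le_iff)
next
  assume "x \<in> L \<union> M \<and> (x = y \<or> E x y)"
  then show "spec_le space x y"
    unfolding spec_le_iff topspace_space openin_space using edge by blast
qed

lemma spec_less_space: "spec_less space x y \<longleftrightarrow> E x y"
  using edge[of x y] disjoint unfolding spec_less_def spec_le_space by blast

lemma t0_space_space: "t0_space space"
proof (rule ccontr)
  assume "\<not> t0_space space"
  then obtain x y where "x \<noteq> y" "spec_le space x y" "spec_le space y x"
    unfolding t0_space_def spec_le_iff by blast
  then show False
    using no_path by (auto simp: spec_le_space)
qed

lemma hasse_space: "hasse space x y \<longleftrightarrow> E x y"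
  using no_path by (auto simp: hasse_def spec_less_space)

lemma deg_space: "deg space x = card {v. E x v \<or> E v x}"
  by (simp add: deg_eq_card_connected[OF t0_space_space] connected_to_def hasse_space)

lemma chain_space:
  assumes "sorted_wrt E xs" "xs \<noteq> []"
  shows "length xs = 1 \<or> (\<exists>w. E w (last xs) \<and> length xs = 2)"
proof (cases xs)
  case (Cons x ys)
  \<comment> \<open>The case splits isolate the first, second and last entries; three entries would
    give two composable edges.\<close>
  then show ?thesis
    using assms(1) no_path by (cases ys rule: rev_cases; cases "butlast ys") auto
qed (use assms in simp)

lemma level_space:
  assumes "x \<in> L \<union> M"
  shows "level space x = (if \<exists>w. E w x then 2 else 1)"
proof -
  let ?C = "{length xs | xs. xs \<noteq> [] \<and> set xs \<subseteq> L \<union> M \<and> sorted_wrt E xs \<and> last xs = x}"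
  have less: "spec_less space = E"
    by (simp add: fun_eq_iff spec_less_space)
  have one: "1 \<in> ?C"
    using assms by (auto intro!: exI[of _ "[x]"])
  have two: "2 \<in> ?C" if "E w x" for w
    using that edge[OF that] by (auto intro!: exI[of _ "[w, x]"])
  have upper: "?C \<subseteq> (if \<exists>w. E w x then {1, 2} else {1})"
    using chain_space by fastforce
  have "?C = (if \<exists>w. E w x then {1, 2} else {1})"
  proof (rule subset_antisym[OF upper])
    show "(if \<exists>w. E w x then {1, 2} else {1}) \<subseteq> ?C"
      using one two by (simp split: if_split) blast
  qed
  then show ?thesis
    by (simp add: level_def less topspace_space)
qed

text \<open>The assumption is needed because an isolated point of M would have level 1.\<close>

lemma level_set_space:
  assumes "\<And>y. y \<in> M \<Longrightarrow> \<exists>x. E x y"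
  shows "level_set space 1 = L" "level_set space 2 = M"
proof -
  have L: "level space x = 1" if "x \<in> L" for x
    using that edge disjoint by (subst level_space) auto
  have M: "level space x = 2" if "x \<in> M" for x
    using that assms by (subst level_space) auto
  show "level_set space 1 = L" "level_set space 2 = M"
    using L M by (auto simp: level_set_def topspace_space)
qed

end

text \<open>With \<open>n = k + 4\<close>, let \<open>i\<close> be the \<open>i\<close>-th lower and \<open>n + j\<close> the \<open>j\<close>-th upper vertex.
  Joining them iff \<open>i + j > n\<close> gives the half graph, with degrees \<open>1, \<dots>, n\<close> on each level;
  the additional edge between the two vertices of degree 1 yields \<open>F\<^sub>k\<close>.\<close>

definition F_edge :: "nat \<Rightarrow> nat \<Rightarrow> nat \<Rightarrow> bool" where
  "F_edge n x y \<longleftrightarrow> x \<in> {1..n} \<and> y \<in> {n + 1..2 * n} \<and> (x + y > 2 * n \<or> x = 1 \<and> y = n + 1)"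

interpretation F: bipartite_poset "{1..n}" "{n + 1..2 * n}" "F_edge n" for n
  by unfold_locales (auto simp: F_edge_def)

text \<open>The half graph gives degree x, and the additional edge raises degree 1 to 2; hence the
  maximum.\<close>

lemma deg_F_lower:
  assumes "n \<ge> 4" "x \<in> {1..n}"
  shows "deg (F.space n) x = max 2 x"
proof (cases "x = 1")
  case True
  then have "{v. F_edge n x v \<or> F_edge n v x} = {n + 1, 2 * n}"
    using assms by (auto simp: F_edge_def)
  then show ?thesis
    unfolding F.deg_space using assms True by simp
next
  case False
  then have "{v. F_edge n x v \<or> F_edge n v x} = {2 * n + 1 - x..2 * n}"
    using assms by (auto simp: F_edge_def)
  then show ?thesis
    unfolding F.deg_space using assms False by simp
qed

lemma deg_F_upper:
  assumes "n \<ge> 4" "j \<in> {1..n}"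
  shows "deg (F.space n) (n + j) = max 2 j"
proof (cases "j = 1")
  case True
  then have "{v. F_edge n (n + j) v \<or> F_edge n v (n + j)} = {1, n}"
    using assms by (auto simp: F_edge_def)
  then show ?thesis
    unfolding F.deg_space using assms True by simp
next
  case False
  then have "{v. F_edge n (n + j) v \<or> F_edge n v (n + j)} = {n + 1 - j..n}"
    using assms by (auto simp: F_edge_def)
  then show ?thesis
    unfolding F.deg_space using assms False by simp
qed

lemma is_F_model: "is_F k (F.space (k + 4))"
proof -
  define n where "n = k + 4"
  define X where "X = F.space n"
  have n: "n \<ge> 4" by (simp add: n_def)
  \<comment> \<open>The lower vertex n is joined to every upper vertex, so no upper vertex is
    isolated.\<close>
  have "F_edge n n y" if "y \<in> {n + 1..2 * n}" for y
    using that by (auto simp: F_edge_def)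
  then have lev: "level_set X 1 = {1..n}" "level_set X 2 = {n + 1..2 * n}"
    unfolding X_def by (intro F.level_set_space; blast)+
  note low = deg_F_lower[OF n, folded X_def] and up = deg_F_upper[OF n, folded X_def]
  have up': "deg X y = max 2 (y - n)" if "y \<in> {n + 1..2 * n}" for y
    using up[of "y - n"] that by fastforce
  have top: "topspace X = {1..n} \<union> {n + 1..2 * n}"
    unfolding X_def by (rule F.topspace_space)
  have conn: "connected_to X x y \<longleftrightarrow> F_edge n x y \<or> F_edge n y x" for x y
    unfolding X_def connected_to_def F.hasse_space ..
  have low2: "{x \<in> level_set X 1. deg X x = 2} = {1, 2}"
    and lowi: "\<And>i. i \<in> {3..n} \<Longrightarrow> {x \<in> level_set X 1. deg X x = i} = {i}"
    unfolding lev using n low by (auto simp: max_def split: if_splits)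
  have up2: "{x \<in> level_set X 2. deg X x = 2} = {n + 1, n + 2}"
    and upi: "\<And>i. i \<in> {3..n} \<Longrightarrow> {x \<in> level_set X 2. deg X x = i} = {n + i}"
    unfolding lev using n up' by (auto simp: max_def split: if_splits)
  have "\<exists>a b. a \<noteq> b \<and> {x \<in> level_set X 1. deg X x = 2} = {a, b} \<and>
        (\<exists>u \<in> level_set X 2. deg X u = 2 \<and> connected_to X a u) \<and>
        (\<exists>u \<in> level_set X 2. deg X u = k + 4 \<and> connected_to X a u) \<and>
        (\<exists>u \<in> level_set X 2. deg X u = k + 3 \<and> connected_to X b u) \<and>
        (\<exists>u \<in> level_set X 2. deg X u = k + 4 \<and> connected_to X b u)"
  \<comment> \<open>Take a = 1, with neighbours n+1 (the additional edge) and 2n, and b = 2, with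
    neighbours 2n-1 and 2n. The upper vertices 2n-1 and 2n have degrees k+3 and k+4.\<close>
  proof (intro exI conjI)
    show "{x \<in> level_set X 1. deg X x = 2} = {1, 2}"
      by (fact low2)
    show "\<exists>u \<in> level_set X 2. deg X u = 2 \<and> connected_to X 1 u"
      unfolding lev conn using n up[of 1] by (intro bexI[of _ "n + 1"]) (auto simp: F_edge_def)
    show "\<exists>u \<in> level_set X 2. deg X u = k + 4 \<and> connected_to X 1 u"
      "\<exists>u \<in> level_set X 2. deg X u = k + 4 \<and> connected_to X 2 u"
      unfolding lev conn using n up[of n] by (intro bexI[of _ "n + n"]; auto simp: F_edge_def n_def)+
    show "\<exists>u \<in> level_set X 2. deg X u = k + 3 \<and> connected_to X 2 u"
      unfolding lev conn using n up[of "n - 1"]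
      by (intro bexI[of _ "n + (n - 1)"]; auto simp: F_edge_def n_def)
  qed simp
  moreover have "\<exists>a b. a \<noteq> b \<and> {x \<in> level_set X 2. deg X x = 2} = {a, b} \<and>
        (\<exists>u \<in> level_set X 1. deg X u = 2 \<and> connected_to X a u) \<and>
        (\<exists>u \<in> level_set X 1. deg X u = k + 4 \<and> connected_to X a u) \<and>
        (\<exists>u \<in> level_set X 1. deg X u = k + 3 \<and> connected_to X b u) \<and>
        (\<exists>u \<in> level_set X 1. deg X u = k + 4 \<and> connected_to X b u)"
  proof (intro exI conjI)
    show "{x \<in> level_set X 2. deg X x = 2} = {n + 1, n + 2}"
      by (fact up2)
    show "\<exists>u \<in> level_set X 1. deg X u = 2 \<and> connected_to X (n + 1) u"
      unfolding lev conn using n low[of 1] by (intro bexI[of _ 1]) (auto simp: F_edge_def)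
    show "\<exists>u \<in> level_set X 1. deg X u = k + 4 \<and> connected_to X (n + 1) u"
      "\<exists>u \<in> level_set X 1. deg X u = k + 4 \<and> connected_to X (n + 2) u"
      unfolding lev conn using n low[of n] by (intro bexI[of _ n]; auto simp: F_edge_def n_def)+
    show "\<exists>u \<in> level_set X 1. deg X u = k + 3 \<and> connected_to X (n + 2) u"
      unfolding lev conn using n low[of "n - 1"]
      by (intro bexI[of _ "n - 1"]; auto simp: F_edge_def n_def)
  qed simp
  moreover have "\<forall>x y. hasse X x y \<longrightarrow> x \<in> level_set X 1 \<and> y \<in> level_set X 2"
    unfolding lev unfolding X_def F.hasse_space F_edge_def by blast
  moreover have "card (topspace X) = 2 * k + 8"
    unfolding top by (subst card_Un_disjoint) (auto simp: n_def)
  ultimately have "is_F k X"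
    unfolding is_F_def using low2 lowi up2 upi F.t0_space_space[of n, folded X_def]
    by (simp add: lev[unfolded One_nat_def] top n_def)
  then show ?thesis
    unfolding X_def n_def .
qed

text \<open>The statements on asymmetry and homotopy type range over all copies of F_k on arbitrary
  types; the existence of copies on \<open>nat\<close> keeps them from being vacuous.\<close>

theorem proposition2p5:
  shows "(\<exists>S :: nat topology set. infinite S \<and>
            (\<forall>X \<in> S. minimal_finite_space X \<and> trivial_group (homeo_group X)) \<and>
            pairwise (\<lambda>X Y. \<not> X homeomorphic_space Y) S) \<and>
         (\<forall>k. \<exists>X :: nat topology. is_F k X) \<and>
         (\<forall>k. \<forall>X :: 'a topology. is_F k X \<longrightarrow> asymmetric_space X) \<and>
         (\<forall>k l. \<forall>(X :: 'a topology) (Y :: 'b topology).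
            k \<noteq> l \<longrightarrow> is_F k X \<longrightarrow> is_F l Y \<longrightarrow> \<not> X homotopy_equivalent_space Y)"
proof (intro conjI allI impI)
  define Fk :: "nat \<Rightarrow> nat topology" where "Fk k = F.space (k + 4)" for k
  have Fk: "is_F k (Fk k)" for k
    unfolding Fk_def by (rule is_F_model)
  have distinct: "\<not> Fk k homeomorphic_space Fk l" if "k \<noteq> l" for k l
    using homeomorphic_space_card_eq[of "Fk k" "Fk l"] is_FD(3)[OF Fk] that by auto
  have "inj Fk"
    using distinct homeomorphic_space_refl by (metis injI)
  then have "infinite (range Fk)"
    by (simp add: finite_image_iff)
  moreover have "trivial_group (homeo_group (Fk k))" for k
    by (rule trivial_homeo_group) (erule (1) is_F_rigid[OF Fk])
  then have "\<forall>X \<in> range Fk. minimal_finite_space X \<and> trivial_group (homeo_group X)"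
    using is_F_minimal[OF Fk] by auto
  moreover have "pairwise (\<lambda>X Y. \<not> X homeomorphic_space Y) (range Fk)"
    unfolding pairwise_def using distinct by (metis imageE)
  ultimately show "\<exists>S :: nat topology set. infinite S \<and>
      (\<forall>X \<in> S. minimal_finite_space X \<and> trivial_group (homeo_group X)) \<and>
      pairwise (\<lambda>X Y. \<not> X homeomorphic_space Y) S"
    by blast
  show "\<exists>X :: nat topology. is_F k X" for k
    using Fk by blast
next
  fix k and X :: "'a topology"
  assume F: "is_F k X"
  show "asymmetric_space X"
    by (rule minimal_asymmetric_space[OF is_F_minimal[OF F]]) (erule (1) is_F_rigid[OF F])
next
  fix k l and X :: "'a topology" and Y :: "'b topology"
  assume *: "k \<noteq> l" "is_F k X" "is_F l Y"
  \<comment> \<open>Between minimal spaces a homotopy equivalence yields a homeomorphism, so the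
    number of points is an invariant here.\<close>
  have "card (topspace X) \<noteq> card (topspace Y)"
    using *(1) is_FD(3)[OF *(2)] is_FD(3)[OF *(3)] by simp
  then show "\<not> X homotopy_equivalent_space Y"
    using homotopy_equivalent_minimal_imp_homeomorphic[OF is_F_minimal[OF *(2)] is_F_minimal[OF *(3)]]
      homeomorphic_space_card_eq[of X Y] by blast
qed

end
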